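(* $\mathbf{R}_s(P_1 \vdash P_2 \diamond P_3)^{\star} = \mathbf{R}_s\big((P_3^{\star} \;\mathbf{wlp}_R\; P_1) \vdash (P_3^{\star} \mathbin{;} P_2) \diamond P_3^{\star}\big)$ and $\mathbf{R}_s(P_1 \vdash P_2 \diamond P_3)^{+} = \mathbf{R}_s\big((P_3^{\star} \;\mathbf{wlp}_R\; P_1) \vdash (P_3^{\star} \mathbin{;} P_2) \diamond P_3^{+}\big)$.
   Context: $\mathbf{R}_s(P_1 \vdash P_2 \diamond P_3) \triangleq \mathbf{R1}\circ\mathbf{R2}\circ\mathbf{R3}_h(ok \land P_1 \Rightarrow ok' \land (P_2 \triangleleft wait' \triangleright P_3))$ is a reactive contract with precondition $P_1$ (a reactive condition), pericondition $P_2$ and postcondition $P_3$ (reactive relations); $\mathbin{;}$ is sequential composition and nondeterministic choice $\sqcap$ is disjunction. Kleene plus is $P^{+} \triangleq \bigvee_{i\in\mathbb{N}} P^{i+1}$, and star is $P^{\star} \triangleq \mathrm{II} \sqcap P^{+}$ for the relevant identity: on the left-hand side (contracts) the identity is the reactive-design skip $\mathrm{II}_{srd}$, while the inner stars on reactive relations use the reactive relational identity $\mathrm{II}_r \triangleq (tr' = tr \land st' = st \land r' = r)$. The reactive weakest liberal precondition is $P \;\mathbf{wlp}_R\; Q \triangleq \neg_r(P \mathbin{;} \neg_r Q)$, where $\neg_r P \triangleq \mathbf{R1}(\neg P)$ and $\mathbf{R1}(P) \triangleq P \land tr \le tr'$.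
   Formalization: The pericondition P_2 is additionally assumed not to mention st'; without this the claim fails, e.g. P_1 = true_r, P_2 = (tr ≤ tr' ∧ st'), P_3 = false, since R3_h conceals the state of a waiting contract. *)

theory Defs
  imports Main
begin

text \<open>
  Traces are taken from an arbitrary trace algebra: a cancellative monoid without inverses, written
  additively. The prefix order and the trace difference are the derived ones.
\<close>

class trace = monoid_add + cancel_semigroup_add +
  assumes add_eq_0_left: "a + b = 0 \<Longrightarrow> a = 0"

definition trace_le :: "'t::trace \<Rightarrow> 't \<Rightarrow> bool"  (infix "\<le>\<^sub>t" 50)
  where "x \<le>\<^sub>t y \<longleftrightarrow> (\<exists>z. y = x + z)"

definition trace_diff :: "'t::trace \<Rightarrow> 't \<Rightarrow> 't"  (infixl "-\<^sub>t" 65)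
  where "y -\<^sub>t x = (if x \<le>\<^sub>t y then THE z. y = x + z else 0)"

text \<open>Standard models: finite event sequences under concatenation, and discrete time.\<close>

instantiation list :: (type) trace
begin

definition zero_list :: "'a list" where "zero_list = []"

definition plus_list :: "'a list \<Rightarrow> 'a list \<Rightarrow> 'a list" where "plus_list = (@)"

instance
  by standard (auto simp: zero_list_def plus_list_def)

end

instance nat :: trace
  by standard auto

text \<open>
  The field \<open>rest\<close> is the variable \<open>r\<close> that collects all further observational variables
  (for instance refusals).
  A relation takes the undashed observation first and the dashed one second; sequential composition
  is \<open>OO\<close> and nondeterministic choice is pointwise disjunction.
\<close>

record ('t, 's, 'r) obs =
  ok :: bool
  wait :: bool
  tr :: 't
  st :: 's
  rest :: 'r

type_synonym ('t, 's, 'r) orel = "('t, 's, 'r) obs \<Rightarrow> ('t, 's, 'r) obs \<Rightarrow> bool"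

definition R1 :: "('t::trace, 's, 'r) orel \<Rightarrow> ('t, 's, 'r) orel"
  where "R1 P = (\<lambda>b b'. P b b' \<and> tr b \<le>\<^sub>t tr b')"

definition R2 :: "('t::trace, 's, 'r) orel \<Rightarrow> ('t, 's, 'r) orel"
  where "R2 P = (\<lambda>b b'. if tr b \<le>\<^sub>t tr b'
                        then P (b\<lparr>tr := 0\<rparr>) (b'\<lparr>tr := tr b' -\<^sub>t tr b\<rparr>)
                        else P b b')"

text \<open>
  A contract whose predecessor is waiting behaves as the identity, except that the
  state is concealed: \<open>(\<exists> st \<bullet> II \<or> (\<not> ok \<and> tr \<le> tr')) \<triangleleft> wait \<triangleright> P\<close>.
\<close>

definition R3h :: "('t::trace, 's, 'r) orel \<Rightarrow> ('t, 's, 'r) orel"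
  where "R3h P = (\<lambda>b b'. if wait b
                         then (\<exists>s. b' = b\<lparr>st := s\<rparr> \<or> (\<not> ok b \<and> tr b \<le>\<^sub>t tr b'))
                         else P b b')"

text \<open>\<open>Rs P1 P2 P3\<close> is the reactive contract with pre-, peri- and postcondition \<open>P1\<close>, \<open>P2\<close>, \<open>P3\<close>.\<close>

definition Rs :: "('t::trace, 's, 'r) orel \<Rightarrow> ('t, 's, 'r) orel \<Rightarrow> ('t, 's, 'r) orel
                  \<Rightarrow> ('t, 's, 'r) orel"
  where "Rs P1 P2 P3 =
    (R1 \<circ> R2 \<circ> R3h)
      (\<lambda>b b'. ok b \<and> P1 b b' \<longrightarrow> ok b' \<and> (if wait b' then P2 b b' else P3 b b'))"

definition not_r :: "('t::trace, 's, 'r) orel \<Rightarrow> ('t, 's, 'r) orel"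
  where "not_r P = R1 (\<lambda>b b'. \<not> P b b')"

definition true_r :: "('t::trace, 's, 'r) orel"
  where "true_r = R1 (\<lambda>b b'. True)"

definition II_r :: "('t::trace, 's, 'r) orel"
  where "II_r = (\<lambda>b b'. tr b' = tr b \<and> st b' = st b \<and> rest b' = rest b)"

definition II_srd :: "('t::trace, 's, 'r) orel"
  where "II_srd = Rs true_r (\<lambda>b b'. False) II_r"

definition wlp_R :: "('t::trace, 's, 'r) orel \<Rightarrow> ('t, 's, 'r) orel \<Rightarrow> ('t, 's, 'r) orel"
  (infixr "wlp\<^sub>R" 75)
  where "P wlp\<^sub>R Q = not_r (P OO not_r Q)"

text \<open>Reactive relations: independent of \<open>ok\<close>, \<open>ok'\<close>, \<open>wait\<close>, \<open>wait'\<close>, and \<open>R1\<close>- and \<open>R2\<close>-healthy.\<close>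

definition RR :: "('t::trace, 's, 'r) orel \<Rightarrow> ('t, 's, 'r) orel"
  where "RR P = (\<lambda>b b'. \<exists>ok\<^sub>0 ok\<^sub>1 wait\<^sub>0 wait\<^sub>1.
    R1 (R2 P) (b\<lparr>ok := ok\<^sub>0, wait := wait\<^sub>0\<rparr>) (b'\<lparr>ok := ok\<^sub>1, wait := wait\<^sub>1\<rparr>))"

definition reactive_relation :: "('t::trace, 's, 'r) orel \<Rightarrow> bool"
  where "reactive_relation P \<longleftrightarrow> RR P = P"

text \<open>
  Reactive conditions are reactive relations whose violation is closed under arbitrary
  continuation, so that they are prefix-closed in the trace and mention neither \<open>st'\<close> nor \<open>r'\<close>.
\<close>

definition RC1 :: "('t::trace, 's, 'r) orel \<Rightarrow> ('t, 's, 'r) orel"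
  where "RC1 P = not_r (not_r P OO true_r)"

definition reactive_condition :: "('t::trace, 's, 'r) orel \<Rightarrow> bool"
  where "reactive_condition P \<longleftrightarrow> reactive_relation P \<and> RC1 P = P"

text \<open>
  \<open>R3h\<close> conceals the state of a waiting contract from its successor, so a pericondition must not
  mention \<open>st'\<close>.
\<close>

definition st'_free :: "('t::trace, 's, 'r) orel \<Rightarrow> bool"
  where "st'_free P \<longleftrightarrow> (\<forall>b b' s. P b (b'\<lparr>st := s\<rparr>) = P b b')"

definition kplus :: "('t::trace, 's, 'r) orel \<Rightarrow> ('t, 's, 'r) orel"
  where "kplus P = (\<lambda>b b'. \<exists>i. (P ^^ (i + 1)) b b')"

definition star_srd :: "('t::trace, 's, 'r) orel \<Rightarrow> ('t, 's, 'r) orel"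
  where "star_srd P = (\<lambda>b b'. II_srd b b' \<or> kplus P b b')"

definition star_r :: "('t::trace, 's, 'r) orel \<Rightarrow> ('t, 's, 'r) orel"
  where "star_r P = (\<lambda>b b'. II_r b b' \<or> kplus P b b')"

end

theory Submission
  imports Defs
begin

text \<open>
  The composition law \<open>Rs P1 P2 P3 OO Rs Q1 Q2 Q3 = Rs (P1 \<and> P3 wlp\<^sub>R Q1) (P2 \<or> P3 OO Q2) (P3 OO Q3)\<close>
  turns the \<open>n+1\<close>-st power of a contract into a single contract whose precondition, pericondition
  and postcondition are \<open>\<And>k\<le>n. P3\<^sup>k wlp\<^sub>R P1\<close>, \<open>\<Or>k\<le>n. P3\<^sup>k OO P2\<close> and \<open>P3\<^sup>n\<^sup>+\<^sup>1\<close>, and the disjunction over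
  all \<open>n\<close> gives the Kleene plus.
\<close>

section \<open>Trace algebra: prefix order and difference\<close>

lemma trace_le_refl [simp]: "x \<le>\<^sub>t (x::'t::trace)"
  unfolding trace_le_def by (metis add_0_right)

lemma trace_le_add [simp]: "x \<le>\<^sub>t (x::'t::trace) + y"
  unfolding trace_le_def by blast

lemma trace_zero_le [simp]: "0 \<le>\<^sub>t (x::'t::trace)"
  unfolding trace_le_def by simp

lemma trace_le_trans: "x \<le>\<^sub>t y \<Longrightarrow> y \<le>\<^sub>t z \<Longrightarrow> x \<le>\<^sub>t (z::'t::trace)"
  unfolding trace_le_def by (metis add.assoc)

text \<open>Left cancellation makes the \<open>THE\<close> in the difference unique.\<close>

lemma trace_diff_add [simp]: "(x + y) -\<^sub>t x = (y::'t::trace)"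
  unfolding trace_diff_def by simp

lemma trace_diff_zero [simp]: "x -\<^sub>t 0 = (x::'t::trace)"
  using trace_diff_add[of 0 x] by simp

lemma trace_diff_eq_zero_iff: "x \<le>\<^sub>t y \<Longrightarrow> y -\<^sub>t x = 0 \<longleftrightarrow> y = (x::'t::trace)"
  by (metis add_0_right trace_diff_add trace_le_def)

section \<open>Reactive relations and their closure properties\<close>

definition rrel :: "('s \<times> 'r \<Rightarrow> 't \<Rightarrow> 's \<times> 'r \<Rightarrow> bool) \<Rightarrow> ('t::trace, 's, 'r) orel"
  where "rrel p = (\<lambda>b b'. \<exists>t. tr b' = tr b + t \<and> p (st b, rest b) t (st b', rest b'))"

text \<open>\<open>R2\<close> leaves only the trace increment visible and the quantifiers of
  \<open>RR\<close> erase \<open>ok\<close> and \<open>wait\<close>. Closure proofs thereby reduce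
  to calculations with kernels \<open>p\<close>.\<close>

lemma reactive_relation_iff_rrel: "reactive_relation P \<longleftrightarrow> (\<exists>p. P = rrel p)"
proof
  assume "reactive_relation P"
  then have P: "RR P = P"
    unfolding reactive_relation_def .
  \<comment> \<open>The kernel is \<open>P\<close> sampled at initial trace \<open>0\<close>, so
    that the final trace is the increment.\<close>
  let ?p = "\<lambda>x t y. \<exists>ok\<^sub>0 ok\<^sub>1 wait\<^sub>0 wait\<^sub>1.
    P \<lparr>ok = ok\<^sub>0, wait = wait\<^sub>0, tr = 0, st = fst x, rest = snd x\<rparr>
      \<lparr>ok = ok\<^sub>1, wait = wait\<^sub>1, tr = t, st = fst y, rest = snd y\<rparr>"
  have "RR P b b' = rrel ?p b b'" for b b'
    by (cases b; cases b') (auto simp: RR_def R1_def R2_def rrel_def trace_le_def, blast+)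
  then show "\<exists>p. P = rrel p"
    unfolding P by blast
next
  assume "\<exists>p. P = rrel p"
  then show "reactive_relation P"
    by (auto simp: reactive_relation_def RR_def R1_def R2_def rrel_def trace_le_def fun_eq_iff)
qed

lemma reactive_relation_rrel [simp]: "reactive_relation (rrel p)"
  unfolding reactive_relation_iff_rrel by blast

lemma reactive_relation_R1: "reactive_relation P \<Longrightarrow> P b b' \<Longrightarrow> tr b \<le>\<^sub>t tr b'"
  by (auto simp: reactive_relation_iff_rrel rrel_def)

lemma reactive_relation_R2:
  assumes "reactive_relation P" "tr b \<le>\<^sub>t tr b'"
  shows "P (b\<lparr>tr := 0\<rparr>) (b'\<lparr>tr := tr b' -\<^sub>t tr b\<rparr>) = P b b'"
  using assms by (auto simp: reactive_relation_iff_rrel rrel_def trace_le_def)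

lemma reactive_relation_ok_wait:
  assumes "reactive_relation P"
  shows "P (b\<lparr>ok := x\<rparr>) b' = P b b'" "P b (b'\<lparr>ok := x\<rparr>) = P b b'"
    "P (b\<lparr>wait := x\<rparr>) b' = P b b'" "P b (b'\<lparr>wait := x\<rparr>) = P b b'"
  using assms by (auto simp: reactive_relation_iff_rrel rrel_def)

lemma rrel_comp:
  "rrel p OO rrel q = rrel (\<lambda>x t z. \<exists>y u v. t = u + v \<and> p x u y \<and> q y v z)"
proof (intro ext iffI)
  fix b b' :: "('a, 'b, 'c) obs"
  assume "rrel (\<lambda>x t z. \<exists>y u v. t = u + v \<and> p x u y \<and> q y v z) b b'"
  then obtain y u v where *: "tr b' = tr b + (u + v)"
      "p (st b, rest b) u y" "q y v (st b', rest b')"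
    unfolding rrel_def by blast
  \<comment> \<open>The midpoint inherits \<open>ok\<close> and \<open>wait\<close> from
    \<open>b\<close>; any values would do, since \<open>rrel\<close> does not see them.\<close>
  have "rrel p b (b\<lparr>tr := tr b + u, st := fst y, rest := snd y\<rparr>)"
    "rrel q (b\<lparr>tr := tr b + u, st := fst y, rest := snd y\<rparr>) b'"
    using * by (auto simp: rrel_def add.assoc)
  then show "(rrel p OO rrel q) b b'"
    by blast
next
  fix b b' :: "('a, 'b, 'c) obs"
  assume "(rrel p OO rrel q) b b'"
  then show "rrel (\<lambda>x t z. \<exists>y u v. t = u + v \<and> p x u y \<and> q y v z) b b'"
    by (fastforce simp: rrel_def add.assoc)
qed

lemma reactive_relation_comp:
  "reactive_relation P \<Longrightarrow> reactive_relation Q \<Longrightarrow> reactive_relation (P OO Q)"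
  unfolding reactive_relation_iff_rrel[of P] reactive_relation_iff_rrel[of Q]
  by (auto simp: rrel_comp)

lemma not_r_rrel: "not_r (rrel p) = rrel (\<lambda>x t y. \<not> p x t y)"
  by (auto simp: not_r_def R1_def rrel_def trace_le_def fun_eq_iff)

lemma reactive_relation_not_r: "reactive_relation P \<Longrightarrow> reactive_relation (not_r P)"
  unfolding reactive_relation_iff_rrel by (metis not_r_rrel)

text \<open>The guard \<open>C\<close> lets one lemma serve bounded disjunctions
  (\<open>k \<le> n\<close>), unbounded ones and, with a Boolean index, binary ones.\<close>

lemma reactive_relation_Ex:
  assumes "\<And>i. reactive_relation (P i)"
  shows "reactive_relation (\<lambda>b b'. \<exists>i. C i \<and> P i b b')"
proof -
  obtain p where "P i = rrel (p i)" for i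
    using assms unfolding reactive_relation_iff_rrel by metis
  then have "(\<lambda>b b'. \<exists>i. C i \<and> P i b b') = rrel (\<lambda>x t y. \<exists>i. C i \<and> p i x t y)"
    by (auto simp: rrel_def fun_eq_iff)
  then show ?thesis
    by simp
qed

lemma reactive_relation_disj:
  assumes "reactive_relation P" "reactive_relation Q"
  shows "reactive_relation (\<lambda>b b'. P b b' \<or> Q b b')"
  using reactive_relation_Ex[of "\<lambda>i. if i then P else Q" "\<lambda>_. True"] assms
  by (simp add: ex_bool_eq)

lemma reactive_relation_conj:
  assumes "reactive_relation P" "reactive_relation Q"
  shows "reactive_relation (\<lambda>b b'. P b b' \<and> Q b b')"
proof -
  \<comment> \<open>De Morgan: \<open>not_r\<close> is an involution on \<open>R1\<close>-healthy
    relations.\<close>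
  have "(\<lambda>b b'. P b b' \<and> Q b b') = not_r (\<lambda>b b'. not_r P b b' \<or> not_r Q b b')"
    using assms[THEN reactive_relation_R1] by (auto simp: not_r_def R1_def fun_eq_iff)
  then show ?thesis
    using assms by (simp add: reactive_relation_not_r reactive_relation_disj)
qed

lemma reactive_relation_False [simp]: "reactive_relation (\<lambda>b b'. False)"
  using reactive_relation_rrel[of "\<lambda>x t y. False"] by (simp add: rrel_def)

lemma reactive_relation_true_r [simp]: "reactive_relation true_r"
proof -
  have *: "true_r = not_r (\<lambda>b b'. False)"
    by (simp add: true_r_def not_r_def)
  show ?thesis
    unfolding * by (intro reactive_relation_not_r reactive_relation_False)
qed

lemma reactive_relation_II_r [simp]: "reactive_relation II_r"
proof -
  have *: "II_r = rrel (\<lambda>x t y. t = 0 \<and> x = y)"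
    by (auto simp: II_r_def rrel_def fun_eq_iff)
  show ?thesis
    unfolding * by (rule reactive_relation_rrel)
qed

lemma II_r_comp:
  assumes "reactive_relation P"
  shows "II_r OO P = P"
proof -
  obtain p where "P = rrel p"
    using assms reactive_relation_iff_rrel by blast
  then show ?thesis
    by (auto simp: II_r_def rrel_def fun_eq_iff)
qed

section \<open>Powers and iteration of reactive relations\<close>

lemma reactive_relation_relpow:
  "reactive_relation P \<Longrightarrow> reactive_relation (P ^^ Suc n)"
  by (induction n) (simp_all add: reactive_relation_comp eq_OO)

text \<open>Prefixing \<open>II_r\<close> only matters at exponent zero, where the relational power is the
  homogeneous identity, which also fixes \<open>ok\<close> and \<open>wait\<close>.\<close>

definition rpow :: "('t::trace, 's, 'r) orel \<Rightarrow> nat \<Rightarrow> ('t, 's, 'r) orel"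
  where "rpow P n = II_r OO P ^^ n"

lemma rpow_0 [simp]: "rpow P 0 = II_r"
  by (simp add: rpow_def OO_eq)

lemma rpow_Suc: "reactive_relation P \<Longrightarrow> rpow P (Suc n) = P ^^ Suc n"
  unfolding rpow_def by (intro II_r_comp reactive_relation_relpow)

lemma reactive_relation_rpow: "reactive_relation P \<Longrightarrow> reactive_relation (rpow P n)"
  by (cases n) (simp_all add: rpow_Suc reactive_relation_relpow del: relpowp.simps)

lemma star_r_eq_rpow:
  assumes "reactive_relation P"
  shows "star_r P = (\<lambda>b b'. \<exists>n. rpow P n b b')"
proof (intro ext)
  fix b b'
  have "(\<exists>n. rpow P n b b') \<longleftrightarrow> rpow P 0 b b' \<or> (\<exists>n. rpow P (Suc n) b b')"
    by (metis not0_implies_Suc)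
  then show "star_r P b b' \<longleftrightarrow> (\<exists>n. rpow P n b b')"
    using assms by (simp add: star_r_def kplus_def rpow_Suc del: relpowp.simps)
qed

lemma reactive_relation_star_r: "reactive_relation P \<Longrightarrow> reactive_relation (star_r P)"
  using reactive_relation_Ex[of "rpow P" "\<lambda>_. True"]
  by (simp add: star_r_eq_rpow reactive_relation_rpow)

lemma reactive_relation_kplus: "reactive_relation P \<Longrightarrow> reactive_relation (kplus P)"
  using reactive_relation_Ex[of "\<lambda>i. P ^^ Suc i" "\<lambda>_. True"]
  by (simp add: kplus_def reactive_relation_relpow del: relpowp.simps)

section \<open>Reactive conditions and weakest liberal preconditions\<close>

text \<open>\<open>true_r\<close> leads from \<open>c\<close> to every \<open>b'\<close> with a
  longer or equal trace, so \<open>RC1\<close> forbids violations at any \<open>c\<close> whose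
  trace lies in between. The case \<open>tr c = tr b'\<close> yields independence of the final
  \<open>st\<close> and \<open>rest\<close>.\<close>

lemma reactive_condition_iff:
  "reactive_condition P \<longleftrightarrow> reactive_relation P \<and>
     (\<forall>b c b'. P b b' \<longrightarrow> tr b \<le>\<^sub>t tr c \<longrightarrow> tr c \<le>\<^sub>t tr b' \<longrightarrow> P b c)"
proof (cases "reactive_relation P")
  case True
  have "RC1 P b b' \<longleftrightarrow>
      tr b \<le>\<^sub>t tr b' \<and> (\<forall>c. tr b \<le>\<^sub>t tr c \<longrightarrow> tr c \<le>\<^sub>t tr b' \<longrightarrow> P b c)" for b b'
    by (auto simp: RC1_def not_r_def true_r_def R1_def)
  then show ?thesis
    using True reactive_relation_R1[OF True]
    unfolding reactive_condition_def fun_eq_iff by (metis trace_le_refl)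
qed (simp add: reactive_condition_def)

lemma wlp_R_iff:
  "(P wlp\<^sub>R Q) b b' \<longleftrightarrow> tr b \<le>\<^sub>t tr b' \<and> (\<forall>c. P b c \<longrightarrow> tr c \<le>\<^sub>t tr b' \<longrightarrow> Q c b')"
  by (auto simp: wlp_R_def not_r_def R1_def)

lemma reactive_relation_wlp_R:
  "reactive_relation P \<Longrightarrow> reactive_relation Q \<Longrightarrow> reactive_relation (P wlp\<^sub>R Q)"
  by (simp add: wlp_R_def reactive_relation_comp reactive_relation_not_r)

text \<open>A shorter final trace leaves fewer midpoints to check, and at those \<open>Q\<close>
  survives by its own prefix closure.\<close>

lemma reactive_condition_wlp_R:
  assumes "reactive_relation P" "reactive_condition Q"
  shows "reactive_condition (P wlp\<^sub>R Q)"
proof -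
  have Q: "reactive_relation Q"
    "\<And>b c b'. Q b b' \<Longrightarrow> tr b \<le>\<^sub>t tr c \<Longrightarrow> tr c \<le>\<^sub>t tr b' \<Longrightarrow> Q b c"
    using assms(2) unfolding reactive_condition_iff by blast+
  have "(P wlp\<^sub>R Q) b c" if "(P wlp\<^sub>R Q) b b'" "tr b \<le>\<^sub>t tr c" "tr c \<le>\<^sub>t tr b'" for b c b'
    using that Q(2) trace_le_trans[OF _ that(3)] unfolding wlp_R_iff by blast
  then show ?thesis
    unfolding reactive_condition_iff using reactive_relation_wlp_R[OF assms(1) Q(1)] by blast
qed

lemma reactive_condition_conj:
  "reactive_condition P \<Longrightarrow> reactive_condition Q \<Longrightarrow> reactive_condition (\<lambda>b b'. P b b' \<and> Q b b')"
  unfolding reactive_condition_iff by (intro conjI reactive_relation_conj) blast+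

lemma II_r_wlp_R:
  assumes "reactive_relation P"
  shows "II_r wlp\<^sub>R P = P"
proof -
  have "II_r wlp\<^sub>R P = not_r (not_r P)"
    using assms by (simp add: wlp_R_def II_r_comp reactive_relation_not_r)
  then show ?thesis
    using reactive_relation_R1[OF assms] by (auto simp: not_r_def R1_def fun_eq_iff)
qed

section \<open>Contracts pointwise, and their composition\<close>

lemma Rs_iff:
  assumes "reactive_relation P1" "reactive_relation P2" "reactive_relation P3"
  shows "Rs P1 P2 P3 b b' \<longleftrightarrow> tr b \<le>\<^sub>t tr b' \<and>
    (if wait b then \<not> ok b \<or> (\<exists>s. b' = b\<lparr>st := s\<rparr>)
     else \<not> ok b \<or> \<not> P1 b b' \<or> ok b' \<and> wait b' \<and> P2 b b' \<or> ok b' \<and> \<not> wait b' \<and> P3 b b')"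
proof (cases "tr b \<le>\<^sub>t tr b'")
  case True
  \<comment> \<open>\<open>R2\<close> also acts on the waiting branch of \<open>R3h\<close>: there a
    zero increment has to be read back as equal traces.\<close>
  have "b'\<lparr>tr := tr b' -\<^sub>t tr b\<rparr> = b\<lparr>tr := 0, st := s\<rparr> \<longleftrightarrow> b' = b\<lparr>st := s\<rparr>" for s
    using trace_diff_eq_zero_iff[OF True] by (cases b; cases b') auto
  then show ?thesis
    using True assms[THEN reactive_relation_R2, OF True]
    by (auto simp: Rs_def R1_def R2_def R3h_def)
qed (simp add: Rs_def R1_def)

text \<open>If the first contract diverges, prefix closure carries the violation of
  \<open>P1\<close> on to the final observation. If it waits, the second acts as the identity up to
  the state, which \<open>st'_free P2\<close> absorbs. If it terminates, the second takes over from
  a \<open>P3\<close>-successor.\<close>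

lemma Rs_comp:
  assumes P: "reactive_condition P1" "reactive_relation P2" "st'_free P2" "reactive_relation P3"
    and Q: "reactive_relation Q1" "reactive_relation Q2" "reactive_relation Q3"
  shows "Rs P1 P2 P3 OO Rs Q1 Q2 Q3 =
    Rs (\<lambda>b b'. P1 b b' \<and> (P3 wlp\<^sub>R Q1) b b') (\<lambda>b b'. P2 b b' \<or> (P3 OO Q2) b b') (P3 OO Q3)"
    (is "?L = ?R")
proof (intro ext)
  fix b b'
  have P1: "reactive_relation P1"
      "\<And>b c b'. P1 b b' \<Longrightarrow> tr b \<le>\<^sub>t tr c \<Longrightarrow> tr c \<le>\<^sub>t tr b' \<Longrightarrow> P1 b c"
    using P(1) unfolding reactive_condition_iff by blast+
  note Rs = Rs_iff[OF P1(1) P(2,4)] Rs_iff[OF Q]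
  note P3 = reactive_relation_ok_wait[OF P(4)] and P3_le = reactive_relation_R1[OF P(4)]
  note Q1 = reactive_relation_ok_wait[OF Q(1)] and Q2 = reactive_relation_ok_wait[OF Q(2)]
    and Q3 = reactive_relation_ok_wait[OF Q(3)]
  note Q_le = reactive_relation_R1[OF Q(2)] reactive_relation_R1[OF Q(3)]
  have R: "?R b b' \<longleftrightarrow> tr b \<le>\<^sub>t tr b' \<and>
    (if wait b then \<not> ok b \<or> (\<exists>s. b' = b\<lparr>st := s\<rparr>)
     else \<not> ok b \<or> \<not> (P1 b b' \<and> (P3 wlp\<^sub>R Q1) b b') \<or>
       ok b' \<and> wait b' \<and> (P2 b b' \<or> (P3 OO Q2) b b') \<or> ok b' \<and> \<not> wait b' \<and> (P3 OO Q3) b b')"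
    using P1 P(2,4) Q
    by (intro Rs_iff reactive_relation_conj reactive_relation_disj reactive_relation_comp
        reactive_relation_wlp_R)
  show "?L b b' \<longleftrightarrow> ?R b b'"
  proof
    assume "?L b b'"
    then obtain c where c: "Rs P1 P2 P3 b c" "Rs Q1 Q2 Q3 c b'"
      by blast
    have le: "tr b \<le>\<^sub>t tr c" "tr c \<le>\<^sub>t tr b'" "tr b \<le>\<^sub>t tr b'"
      using c trace_le_trans unfolding Rs by blast+
    \<comment> \<open>Started in divergence, predecessor waiting, precondition violated, quiescent,
      terminated.\<close>
    consider "\<not> ok b" | "ok b" "wait b" | "ok b" "\<not> wait b" "\<not> P1 b c"
      | "ok b" "\<not> wait b" "ok c" "wait c" "P2 b c"
      | "ok b" "\<not> wait b" "ok c" "\<not> wait c" "P3 b c"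
      using c(1) unfolding Rs by (auto split: if_splits)
    then show "?R b b'"
    proof cases
      case 1
      then show ?thesis
        using le R by simp
    next
      case 2
      then show ?thesis
        using le c unfolding R Rs by auto
    next
      case 3
      then show ?thesis
        using le P1(2) unfolding R by auto
    next
      case 4
      then obtain s where "b' = c\<lparr>st := s\<rparr>"
        using c(2) unfolding Rs by auto
      then show ?thesis
        using 4 le P(3) unfolding R st'_free_def by auto
    next
      case 5
      then show ?thesis
        using le c(2) unfolding R unfolding Rs wlp_R_iff by auto
    qed
  next
    assume R': "?R b b'"
    then have le: "tr b \<le>\<^sub>t tr b'"
      using R by blast
    \<comment> \<open>A failing \<open>wlp\<^sub>R\<close>, \<open>P3 OO Q2\<close> and
      \<open>P3 OO Q3\<close> each supply such a \<open>c\<close>. Setting its flags to a properly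
      terminated observation is harmless, because the reactive relations ignore \<open>ok\<close>
      and \<open>wait\<close>.\<close>
    have step: "?L b b'" if "ok b" "\<not> wait b" "P3 b c" "tr c \<le>\<^sub>t tr b'"
        "\<not> Q1 c b' \<or> ok b' \<and> wait b' \<and> Q2 c b' \<or> ok b' \<and> \<not> wait b' \<and> Q3 c b'" for c
      using that P3_le[OF that(3)] unfolding OO_def Rs
      by (intro exI[of _ "c\<lparr>ok := True, wait := False\<rparr>"]) (auto simp: P3 Q1 Q2 Q3)
    consider "\<not> ok b" | "ok b" "wait b" | "ok b" "\<not> wait b" "\<not> P1 b b'"
      | "ok b" "\<not> wait b" "ok b'" "wait b'" "P2 b b'"
      | c where "ok b" "\<not> wait b" "P3 b c" "tr c \<le>\<^sub>t tr b'"
        "\<not> Q1 c b' \<or> ok b' \<and> wait b' \<and> Q2 c b' \<or> ok b' \<and> \<not> wait b' \<and> Q3 c b'"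
      using R' Q_le le unfolding R unfolding wlp_R_iff OO_def if_bool_eq_disj by blast
    then show "?L b b'"
    proof cases
      case 1
      then show ?thesis
        using le unfolding OO_def Rs by (intro exI[of _ b]) auto
    next
      case 2
      then show ?thesis
        using R' le unfolding R unfolding OO_def Rs by (intro exI[of _ b]) (auto intro: exI[of _ "st b"])
    next
      case 3
      then show ?thesis
        using le unfolding OO_def Rs
        \<comment> \<open>The first contract diverges and produces the whole trace itself; the
          second, started with \<open>ok\<close> false, may then reach \<open>b'\<close>.\<close>
        by (intro exI[of _ "b'\<lparr>ok := False\<rparr>"])
          (auto simp: reactive_relation_ok_wait[OF P1(1)])
    next
      case 4
      then show ?thesis
        \<comment> \<open>The waiting \<open>b'\<close> is itself the midpoint, and the second
          contract keeps it, state included.\<close>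
        using le unfolding OO_def Rs by (intro exI[of _ b']) (auto intro: exI[of _ "st b'"])
    next
      case 5
      then show ?thesis
        by (rule step)
    qed
  qed
qed

section \<open>Powers and Kleene iteration of contracts\<close>

text \<open>Powers grow by a factor on the right, so the left operand of \<open>Rs_comp\<close> is
  the power built so far; hence the induction also carries that its precondition is a reactive
  condition. It starts at exponent one, as power zero is equality, which is no contract.\<close>

lemma Rs_relpow:
  assumes P: "reactive_condition P1" "reactive_relation P2" "st'_free P2" "reactive_relation P3"
  shows "Rs P1 P2 P3 ^^ Suc n =
    Rs (\<lambda>b b'. \<forall>k\<le>n. (rpow P3 k wlp\<^sub>R P1) b b') (\<lambda>b b'. \<exists>k\<le>n. (rpow P3 k OO P2) b b')
      (P3 ^^ Suc n) \<and>
    reactive_condition (\<lambda>b b'. \<forall>k\<le>n. (rpow P3 k wlp\<^sub>R P1) b b')"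
proof (induction n)
  case 0
  have "reactive_relation P1"
    using P(1) unfolding reactive_condition_def by blast
  then show ?case
    using P by (simp add: II_r_wlp_R II_r_comp eq_OO)
next
  case (Suc n)
  let ?A = "\<lambda>n b b'. \<forall>k\<le>n. (rpow P3 k wlp\<^sub>R P1) b b'"
  let ?B = "\<lambda>n b b'. \<exists>k\<le>n. (rpow P3 k OO P2) b b'"
  have P1: "reactive_relation P1"
    using P(1) unfolding reactive_condition_def by blast
  \<comment> \<open>The only new index is \<open>Suc n\<close>, where \<open>rpow\<close> is the
    ordinary power that \<open>Rs_comp\<close> produces.\<close>
  have A: "?A (Suc n) = (\<lambda>b b'. ?A n b b' \<and> (P3 ^^ Suc n wlp\<^sub>R P1) b b')"
    by (auto simp: le_Suc_eq rpow_Suc[OF P(4)] fun_eq_iff simp del: relpowp.simps)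
  have B: "?B (Suc n) = (\<lambda>b b'. ?B n b b' \<or> (P3 ^^ Suc n OO P2) b b')"
    by (rule ext, rule ext, unfold le_Suc_eq rpow_Suc[OF P(4), symmetric]) blast
  have "reactive_relation (?B n)"
    using P by (intro reactive_relation_Ex reactive_relation_comp reactive_relation_rpow)
  \<comment> \<open>Every disjunct ends with \<open>P2\<close>, which alone sees the final
    state.\<close>
  moreover have "st'_free (?B n)"
    using P(3) unfolding st'_free_def OO_def by simp
  ultimately have "Rs (?A n) (?B n) (P3 ^^ Suc n) OO Rs P1 P2 P3
      = Rs (?A (Suc n)) (?B (Suc n)) (P3 ^^ Suc n OO P3)"
    unfolding A B using Suc.IH P P1 by (intro Rs_comp reactive_relation_relpow) auto
  moreover have "reactive_condition (?A (Suc n))"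
    unfolding A using Suc.IH P
    by (intro reactive_condition_conj reactive_condition_wlp_R reactive_relation_relpow) auto
  moreover have "Rs P1 P2 P3 ^^ Suc (Suc n) = (Rs P1 P2 P3 ^^ Suc n) OO Rs P1 P2 P3"
    "P3 ^^ Suc (Suc n) = P3 ^^ Suc n OO P3"
    by simp_all
  ultimately show ?case
    using Suc.IH by metis
qed

text \<open>A disjunction of contracts disjoins the violations of the preconditions, the
  periconditions and the postconditions separately.\<close>

lemma kplus_Rs:
  assumes P: "reactive_condition P1" "reactive_relation P2" "st'_free P2" "reactive_relation P3"
  shows "kplus (Rs P1 P2 P3) = Rs (star_r P3 wlp\<^sub>R P1) (star_r P3 OO P2) (kplus P3)"
proof (intro ext)
  fix b b'
  let ?A = "\<lambda>n b b'. \<forall>k\<le>n. (rpow P3 k wlp\<^sub>R P1) b b'"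
  let ?B = "\<lambda>n b b'. \<exists>k\<le>n. (rpow P3 k OO P2) b b'"
  have P1: "reactive_relation P1"
    using P(1) unfolding reactive_condition_def by blast
  have A: "reactive_relation (?A n)" for n
    using Rs_relpow[OF P, of n] unfolding reactive_condition_def by blast
  have B: "reactive_relation (?B n)" for n
    using P by (intro reactive_relation_Ex reactive_relation_comp reactive_relation_rpow)
  have "kplus (Rs P1 P2 P3) b b' \<longleftrightarrow> (\<exists>n. Rs (?A n) (?B n) (P3 ^^ Suc n) b b')"
    using Rs_relpow[OF P] by (simp add: kplus_def del: relpowp.simps)
  also have "\<dots> \<longleftrightarrow> (\<exists>n. tr b \<le>\<^sub>t tr b' \<and>
    (if wait b then \<not> ok b \<or> (\<exists>s. b' = b\<lparr>st := s\<rparr>)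
     else \<not> ok b \<or> \<not> ?A n b b' \<or> ok b' \<and> wait b' \<and> ?B n b b'
       \<or> ok b' \<and> \<not> wait b' \<and> (P3 ^^ Suc n) b b'))"
    by (simp only: Rs_iff[OF A B reactive_relation_relpow[OF P(4)]])
  also have "\<dots> \<longleftrightarrow> tr b \<le>\<^sub>t tr b' \<and>
    (if wait b then \<not> ok b \<or> (\<exists>s. b' = b\<lparr>st := s\<rparr>)
     else \<not> ok b \<or> (\<exists>n. \<not> ?A n b b') \<or> ok b' \<and> wait b' \<and> (\<exists>n. ?B n b b')
       \<or> ok b' \<and> \<not> wait b' \<and> (\<exists>n. (P3 ^^ Suc n) b b'))"
    by (cases "wait b") (simp_all only: if_True if_False ex_simps ex_disj_distrib, blast+)
  also have "\<dots> \<longleftrightarrow> tr b \<le>\<^sub>t tr b' \<and>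
    (if wait b then \<not> ok b \<or> (\<exists>s. b' = b\<lparr>st := s\<rparr>)
     else \<not> ok b \<or> \<not> (star_r P3 wlp\<^sub>R P1) b b' \<or> ok b' \<and> wait b' \<and> (star_r P3 OO P2) b b'
       \<or> ok b' \<and> \<not> wait b' \<and> kplus P3 b b')"
  proof -
    \<comment> \<open>As \<open>n\<close> ranges over all naturals, the bound
      \<open>k \<le> n\<close> disappears; a conjunction of \<open>wlp\<^sub>R\<close> over all
      powers is the \<open>wlp\<^sub>R\<close> of their union.\<close>
    have "(\<exists>n. \<not> ?A n b b') \<longleftrightarrow> \<not> (star_r P3 wlp\<^sub>R P1) b b'" if "tr b \<le>\<^sub>t tr b'"
      using that unfolding star_r_eq_rpow[OF P(4)] wlp_R_iff by blast
    moreover have "(\<exists>n. ?B n b b') \<longleftrightarrow> (star_r P3 OO P2) b b'"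
      unfolding star_r_eq_rpow[OF P(4)] by blast
    ultimately show ?thesis
      by (auto simp: kplus_def simp del: relpowp.simps)
  qed
  also have "\<dots> \<longleftrightarrow> Rs (star_r P3 wlp\<^sub>R P1) (star_r P3 OO P2) (kplus P3) b b'"
    using P P1 by (intro Rs_iff[symmetric] reactive_relation_wlp_R reactive_relation_comp
      reactive_relation_star_r reactive_relation_kplus)
  finally show "kplus (Rs P1 P2 P3) b b'
      = Rs (star_r P3 wlp\<^sub>R P1) (star_r P3 OO P2) (kplus P3) b b'" .
qed

theorem theorem11:
  fixes P1 P2 P3 :: "('t::trace, 's, 'r) orel"
  assumes "reactive_condition P1"
    and "reactive_relation P2" and "st'_free P2"
    and "reactive_relation P3"
  shows "star_srd (Rs P1 P2 P3)
           = Rs (star_r P3 wlp\<^sub>R P1) (star_r P3 OO P2) (star_r P3)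
       \<and> kplus (Rs P1 P2 P3)
           = Rs (star_r P3 wlp\<^sub>R P1) (star_r P3 OO P2) (kplus P3)"
proof
  show "kplus (Rs P1 P2 P3) = Rs (star_r P3 wlp\<^sub>R P1) (star_r P3 OO P2) (kplus P3)"
    using assms by (rule kplus_Rs)
  have pre: "reactive_relation (star_r P3 wlp\<^sub>R P1)" and peri: "reactive_relation (star_r P3 OO P2)"
    using assms unfolding reactive_condition_def
    by (auto intro!: reactive_relation_wlp_R reactive_relation_comp reactive_relation_star_r)
  note post = reactive_relation_star_r[OF assms(4)] reactive_relation_kplus[OF assms(4)]
  \<comment> \<open>Along growing traces \<open>II_srd\<close> never violates its precondition and
    has no quiescent behaviour. Beyond the waiting and diverged cases shared by all contracts, it
    only adds \<open>II_r\<close> to the postcondition, turning \<open>kplus P3\<close> into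
    \<open>star_r P3\<close>.\<close>
  have "star_srd (Rs P1 P2 P3) b b'
      \<longleftrightarrow> Rs (star_r P3 wlp\<^sub>R P1) (star_r P3 OO P2) (star_r P3) b b'" for b b'
    unfolding star_srd_def II_srd_def kplus_Rs[OF assms] Rs_iff[OF pre peri post(1)]
      Rs_iff[OF pre peri post(2)]
      Rs_iff[OF reactive_relation_true_r reactive_relation_False reactive_relation_II_r]
    by (auto simp: true_r_def R1_def star_r_def)
  then show "star_srd (Rs P1 P2 P3)
      = Rs (star_r P3 wlp\<^sub>R P1) (star_r P3 OO P2) (star_r P3)"
    by blast
qed

end
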